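(* Let $n\ge 3$ and $3\le k<n$, and let $(C_n,L)$ be an edge-labeled $n$-cycle with positive integer edge labels $\ell_1,\dots,\ell_n$. If $(0,\dots,0,g_k,\dots,g_n)$ (with $k-1$ leading zeros) is a generalized spline on $(C_n,L)$, then $g_k$ is a multiple of $\operatorname{lcm}(\ell_{k-1},\gcd(\ell_k,\dots,\ell_n))$. Moreover, $\operatorname{lcm}(\ell_{k-1},\gcd(\ell_k,\dots,\ell_n))$ is the smallest positive value of $g_k$ for which such a spline $(0,\dots,0,g_k,\dots,g_n)$ exists, i.e. there is a flow-up class $\mathcal{G}_{k-1}$ with leading entry $g_k=\operatorname{lcm}(\ell_{k-1},\gcd(\ell_k,\dots,\ell_n))$.
   Context: An edge-labeled $n$-cycle $(C_n,L)$: vertices $v_1,\dots,v_n$; edge $e_i$ joins $v_i$ and $v_{i+1}$ for $1\le i\le n-1$, and $e_n$ joins $v_n$ and $v_1$; edge $e_i$ carries label $\ell_i$. A generalized spline on $(C_n,L)$ is a tuple $(g_1,\dots,g_n)\in\mathbb{Z}^n$ with $g_i\equiv g_{i+1}\pmod{\ell_i}$ for $1\le i\le n-1$ and $g_n\equiv g_1\pmod{\ell_n}$. A flow-up class $\mathcal{G}_{k-1}$ is a spline whose first $k-1$ entries are $0$ and whose $k$-th entry (the leading element) is nonzero. *)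

theory Defs
  imports "HOL-Number_Theory.Cong"
begin

text \<open>
  Vertex and edge labels are functions on \<open>nat\<close> of which only the values at
  \<open>1, \<dots>, n\<close> matter: \<open>l i\<close> is the label of the edge joining vertices \<open>i\<close> and \<open>i + 1\<close>
  for \<open>i < n\<close>, and \<open>l n\<close> is the label of the edge joining vertices \<open>n\<close> and \<open>1\<close>.
\<close>

definition cycle_spline :: "nat \<Rightarrow> (nat \<Rightarrow> int) \<Rightarrow> (nat \<Rightarrow> int) \<Rightarrow> bool" where
  "cycle_spline n l g \<longleftrightarrow>
     (\<forall>i\<in>{1..n - 1}. [g i = g (i + 1)] (mod l i)) \<and> [g n = g 1] (mod l n)"

definition leading_zeros :: "nat \<Rightarrow> (nat \<Rightarrow> int) \<Rightarrow> bool" where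
  "leading_zeros j g \<longleftrightarrow> (\<forall>i\<in>{1..j}. g i = 0)"

definition flow_up_class :: "nat \<Rightarrow> (nat \<Rightarrow> int) \<Rightarrow> nat \<Rightarrow> (nat \<Rightarrow> int) \<Rightarrow> bool" where
  "flow_up_class n l j g \<longleftrightarrow> cycle_spline n l g \<and> leading_zeros j g \<and> g (j + 1) \<noteq> 0"

end

theory Submission
  imports Defs
begin

text \<open>
  Along the arc of vertices \<open>k, \<dots>, n, 1\<close> all entries agree modulo the gcd of the labels
  \<open>l k, \<dots>, l n\<close>, and the entry at vertex 1 vanishes, so the gcd divides the entry at \<open>k\<close>.
  Conversely, any multiple of this gcd can be carried to zero along the arc: by Bezout, it is
  congruent modulo \<open>l k\<close> to a multiple of the gcd of the remaining labels, which
  becomes the next entry.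
\<close>

lemma ex_cong_multiple_if_gcd_dvd:
  fixes a m d :: int
  assumes "gcd m d dvd a"
  shows "\<exists>b. d dvd b \<and> [a = b] (mod m)"
proof -
  obtain c where c: "a = gcd m d * c"
    using assms by (elim dvdE)
  obtain u v where uv: "u * m + v * d = gcd m d"
    using bezout_int by blast
  \<comment> \<open>Scaling the Bezout identity by \<open>c\<close> splits \<open>a\<close> into a
    multiple of \<open>m\<close> and a multiple of \<open>d\<close>; the latter,
    \<open>v * d * c\<close>, is the witness.\<close>
  have "a - v * d * c = m * (u * c)"
    by (simp add: c uv [symmetric] algebra_simps)
  then have "[a = v * d * c] (mod m)"
    by (metis cong_iff_dvd_diff dvd_triv_left)
  then show ?thesis
    by (metis dvd_mult2 dvd_triv_right)
qed

text \<open>The condition \<open>l n dvd h n\<close> stands for the closing edge \<open>n\<close>,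
  whose other end, vertex 1, will carry 0.\<close>

lemma ex_path_labeling_to_zero:
  fixes l :: "nat \<Rightarrow> int"
  assumes "k \<le> n" and "Gcd (l ` {k..n}) dvd a"
  shows "\<exists>h. h k = a \<and> (\<forall>i\<in>{k..<n}. [h i = h (i + 1)] (mod l i)) \<and> l n dvd h n"
  using assms
\<comment> \<open>The induction moves \<open>k\<close> down from \<open>n\<close>; \<open>a\<close>
  is generalized because the hypothesis is applied to the next entry \<open>b\<close>.\<close>
proof (induction k arbitrary: a rule: inc_induct)
  case base
  then show ?case
    by (intro exI [of _ "\<lambda>_. a"]) simp
next
  case (step k)
  have "{k..n} = insert k {Suc k..n}"
    using step.hyps by auto
  then have "gcd (l k) (Gcd (l ` {Suc k..n})) dvd a"
    using step.prems by simp
  then obtain b where b: "Gcd (l ` {Suc k..n}) dvd b" "[a = b] (mod l k)"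
    using ex_cong_multiple_if_gcd_dvd by blast
  obtain h where h: "h (Suc k) = b" "l n dvd h n"
      "\<And>i. i \<in> {Suc k..<n} \<Longrightarrow> [h i = h (i + 1)] (mod l i)"
    using step.IH [OF b(1)] by blast
  have "[(h(k := a)) i = (h(k := a)) (i + 1)] (mod l i)" if "i \<in> {k..<n}" for i
    using that h(1,3) b(2) by (cases "i = k") auto
  then show ?case
    using h(2) step.hyps by (intro exI [of _ "h(k := a)"]) auto
qed

lemma Gcd_labels_dvd_path_start:
  fixes l g :: "nat \<Rightarrow> int"
  assumes "k \<le> n" and "\<And>i. i \<in> {k..<n} \<Longrightarrow> [g i = g (i + 1)] (mod l i)" and "l n dvd g n"
  shows "Gcd (l ` {k..n}) dvd g k"
proof -
  let ?d = "Gcd (l ` {k..n})"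
  have dvd: "?d dvd l i" if "i \<in> {k..n}" for i
    using that by (intro Gcd_dvd) auto
  from assms(1) show ?thesis
  \<comment> \<open>Divisibility travels backwards from \<open>n\<close> to \<open>k\<close>: every
    label on the arc is a multiple of \<open>?d\<close>, so each edge congruence weakens to one
    modulo \<open>?d\<close>.\<close>
  proof (rule inc_induct [where P = "\<lambda>i. ?d dvd g i"])
    show "?d dvd g n"
      using dvd [of n] assms(1,3) dvd_trans by auto
  next
    fix i
    assume i: "k \<le> i" "i < n" "?d dvd g (Suc i)"
    then have "[g i = g (Suc i)] (mod ?d)"
      using assms(2) [of i] dvd [of i] by (auto intro: cong_dvd_modulus)
    then show "?d dvd g i"
      using i(3) cong_dvd_iff by blast
  qed
qed

theorem theorem4p5:
  fixes n k :: nat and l :: "nat \<Rightarrow> int"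
  assumes "n \<ge> 3" and "3 \<le> k" and "k < n"
    and "\<And>i. i \<in> {1..n} \<Longrightarrow> l i > 0"
  shows "(\<forall>g. cycle_spline n l g \<and> leading_zeros (k - 1) g \<longrightarrow>
            lcm (l (k - 1)) (Gcd (l ` {k..n})) dvd g k) \<and>
         lcm (l (k - 1)) (Gcd (l ` {k..n})) > 0 \<and>
         (\<exists>g. flow_up_class n l (k - 1) g \<and> g k = lcm (l (k - 1)) (Gcd (l ` {k..n}))) \<and>
         (\<forall>g. cycle_spline n l g \<and> leading_zeros (k - 1) g \<and> g k > 0 \<longrightarrow>
            lcm (l (k - 1)) (Gcd (l ` {k..n})) \<le> g k)"
proof -
  define m where "m = lcm (l (k - 1)) (Gcd (l ` {k..n}))"
  have m_dvd: "m dvd g k" if "cycle_spline n l g" "leading_zeros (k - 1) g" for g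
  proof -
    have edge: "[g i = g (i + 1)] (mod l i)" if "i \<in> {1..n - 1}" for i
      using \<open>cycle_spline n l g\<close> that by (simp add: cycle_spline_def)
    \<comment> \<open>These are the zeros at the far ends of the closing edge \<open>n\<close> and
      of edge \<open>k - 1\<close>; they yield the two divisors of \<open>g k\<close> that make up
      the lcm.\<close>
    have "g 1 = 0" "g (k - 1) = 0"
      using \<open>leading_zeros (k - 1) g\<close> assms(2) by (auto simp: leading_zeros_def)
    moreover have "[g n = g 1] (mod l n)"
      using \<open>cycle_spline n l g\<close> by (simp add: cycle_spline_def)
    ultimately have "l n dvd g n"
      by (simp add: cong_0_iff)
    then have "Gcd (l ` {k..n}) dvd g k"
      using assms(2,3) edge by (intro Gcd_labels_dvd_path_start) auto
    moreover have "l (k - 1) dvd g k"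
    proof -
      have "[0 = g k] (mod l (k - 1))"
        using edge [of "k - 1"] \<open>g (k - 1) = 0\<close> assms(2,3) by force
      then show ?thesis
        using cong_0_iff cong_sym by blast
    qed
    ultimately show ?thesis
      by (simp add: m_def)
  qed
  have "l n \<noteq> 0" "l (k - 1) \<noteq> 0"
    using assms(4) [of n] assms(4) [of "k - 1"] assms(2,3) by force+
  \<comment> \<open>The set contains the nonzero label \<open>l n\<close>.\<close>
  then have "Gcd (l ` {k..n}) \<noteq> 0"
    using assms(3) by (auto simp: Gcd_0_iff image_subset_iff)
  then have m_pos: "m > 0"
    using \<open>l (k - 1) \<noteq> 0\<close> by (simp add: m_def lcm_pos_int)
  obtain h where h: "h k = m" "l n dvd h n"
      "\<And>i. i \<in> {k..<n} \<Longrightarrow> [h i = h (i + 1)] (mod l i)"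
    using ex_path_labeling_to_zero [of k n l m] assms(3) by (auto simp: m_def)
  \<comment> \<open>The leading zeros are glued to the arc labeling. Two edges join the pieces: edge
    \<open>k - 1\<close>, compatible since \<open>l (k - 1)\<close> divides \<open>m\<close>, and
    edge \<open>n\<close>, compatible since \<open>l n\<close> divides \<open>h n\<close>.\<close>
  define g where "g i = (if i < k then 0 else h i)" for i
  have "[g i = g (i + 1)] (mod l i)" if "i \<in> {1..n - 1}" for i
  proof -
    consider "i + 1 < k" | "i + 1 = k" | "k \<le> i"
      by linarith
    then show ?thesis
    proof cases
      case 2
      then have "l i dvd m"
        by (auto simp: m_def)
      then have "[0 = m] (mod l i)"
        using cong_0_iff cong_sym by blast
      then show ?thesis
        using 2 h(1) by (simp add: g_def)
    next
      case 3
      then show ?thesis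
        using h(3) [of i] that by (auto simp: g_def)
    qed (simp add: g_def)
  qed
  then have "flow_up_class n l (k - 1) g" "g k = m"
    using h(1,2) m_pos assms(2,3)
    by (auto simp: flow_up_class_def cycle_spline_def leading_zeros_def g_def cong_0_iff)
  moreover have "m \<le> g k" if "cycle_spline n l g" "leading_zeros (k - 1) g" "g k > 0" for g
    using m_dvd that zdvd_imp_le by blast
  ultimately show ?thesis
    using m_dvd m_pos unfolding m_def [symmetric] by blast
qed

end
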